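(* For the consistency problem for definite multi-context systems (MCSs), and likewise for the problems of brave and of cautious reasoning with respect to a definite MCS and a query $p$, there is a deterministic algorithm $\mathcal{A}$ deciding the problem such that, over uniform-cost definite MCSs $M=(C_1,\ldots,C_n)$ with $n$ contexts and $m$ bridge rules, the worst-case context-independent time complexity satisfies $$\mathrm{CTime}_{\mathcal{A}}(n,m)\le n\cdot m .$$ Moreover, for the consistency problem, for every definite MCS $M=(C_1,\ldots,C_n)$ (not necessarily uniform-cost) with $n$ contexts and $m$ bridge rules, $\mathrm{Cost}_{\mathcal{A}}(M)\le c\cdot\mathrm{CTime}_{\mathcal{A}}(n,m)$, where $c=\max_{i=1,\ldots,n}\mathrm{cost}(\mathsf{ACC}_i)$.
   Context: Logic suite: a tuple $L=(\mathsf{KB},\mathsf{BS},\mathsf{ACC},\mathrm{cost})$, where $\mathsf{KB}$ is a set of finite knowledge bases (each a finite set, $\emptyset\in\mathsf{KB}$), $\mathsf{BS}$ is a set of finite belief sets, $\mathsf{ACC}:\mathsf{KB}\to 2^{\mathsf{BS}}$ is a semantic operator returning the set of acceptable belief sets of a knowledge base $kb$ (each of cardinality polynomial in the size of $kb$), and $\mathrm{cost}:\mathsf{KB}\to\mathbb{R}^+$ gives the cost of one execution of $\mathsf{ACC}$ on a knowledge base. Put $\mathrm{cost}(\mathsf{ACC})=\max_{kb\in\mathsf{KB}}\mathrm{cost}(kb)$ (assumed to exist). $L$ is monotonic iff $\mathsf{ACC}(kb)$ is a singleton for every $kb\in\mathsf{KB}$, and $kb\subseteq kb'$, $\mathsf{ACC}(kb)=\{S\}$,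 $\mathsf{ACC}(kb')=\{S'\}$ imply $S\subseteq S'$. MCS: $M=(C_1,\ldots,C_n)$ with contexts $C_i=(L_i,br_i)$, $L_i=(\mathsf{KB}_i,\mathsf{BS}_i,\mathsf{ACC}_i,\mathrm{cost}_i)$ a logic suite and $br_i$ a finite set of $L_i$-bridge rules of the form $s\leftarrow (c_1:p_1),\ldots,(c_j:p_j),\,\mathit{not}\,(c_{j+1}:p_{j+1}),\ldots,\mathit{not}\,(c_l:p_l)$, where $c_k\in\{1,\ldots,n\}$, $p_k$ is an element of some belief set in $\mathsf{BS}_{c_k}$, and $kb\cup\{s\}\in\mathsf{KB}_i$ for every $kb\in\mathsf{KB}_i$. Write $\mathrm{head}(r)=s$. The number of bridge rules of $M$ is $m=\sum_i|br_i|$. $M$ is definite iff all $L_i$ are monotonic and no bridge rule contains $\mathit{not}$. Belief state: $S=(S_1,\ldots,S_n)$ with $S_i\in\mathsf{BS}_i$. A bridge rule $s\leftarrow (c_1:p_1),\ldots,(c_j:p_j),\,\mathit{not}\,(c_{j+1}:p_{j+1}),\ldots,\mathit{not}\,(c_l:p_l)$ is satisfied in $S$ iff $p_k\in S_{c_k}$ for $k\le j$ and $p_k\notin S_{c_k}$ for $k>j$. $S$ is an equilibrium of $M$ iff for every $i$, $S_i\in\mathsf{ACC}_i(kb_i)$ where $kb_i=\{\mathrm{head}(r)\mid r\in br_i \text{ satisfied in } S\}$. For a definite $M$, the grounded equilibrium is the unique set-inclusion minimal equilibrium (inclusion taken componentwise); the paper treats it as the only equilibrium of a definite MCS, so for definite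 MCSs both brave and cautious reasoning mean deciding whether the grounded equilibrium entails $p$. Problems: consistency is deciding whether $M$ has an equilibrium. $S$ entails a query $p$ iff $p\in S_i$ for some $i$. Brave (cautious) reasoning is deciding whether some equilibrium (all equilibria) of $M$ entail $p$. Cost model: an algorithm knows the bridge rules of $M$ and accesses the contexts' semantics only by invoking the operators $\mathsf{ACC}_i$ on knowledge bases. If $\mathcal{A}$ on $M$ performs the invocations $\mathsf{ACC}_{c_1},\ldots,\mathsf{ACC}_{c_t}$, then $\mathrm{Cost}_{\mathcal{A}}(M)=\sum_{k=1}^{t}\mathrm{cost}(\mathsf{ACC}_{c_k})$ (all other computation is free); for reasoning problems take the maximum over queries $p$ as well. $M$ is uniform-cost iff $\mathrm{cost}(\mathsf{ACC}_i)=1$ for all $i$. $\mathrm{CTime}_{\mathcal{A}}(n,m)$ is the maximum of $\mathrm{Cost}_{\mathcal{A}}(M)$ over uniform-cost (here: definite) MCSs with exactly $n$ contexts and $m$ bridge rules, i.e. the worst-case number of invocations of semantic operators.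
   Formalization: For brave and cautious reasoning the bound CTime(n,m) ≤ n·m is stated only for n ≥ 2 and m ≥ 2, since for n = 1 or m ≤ 1 it fails (e.g. with m = 0 the answer still depends on ACC_i(∅)); the algorithms are correct for all definite MCSs. *)

theory Defs
  imports
    "HOL-Library.Extended_Nonnegative_Real"
    "HOL-Computational_Algebra.Polynomial"
begin

section \<open>Logic suites\<close>

text \<open>The type variable \<open>'k\<close> ranges over elements of knowledge bases and \<open>'b\<close> over elements of
  belief sets; contexts with different vocabularies share these two universes.  The values of
  \<open>ACC\<close> and \<open>cost\<close> matter on \<open>KB\<close> only.\<close>

record ('k, 'b) logic_suite =
  KB :: "'k set set"
  BS :: "'b set set"
  ACC :: "'k set \<Rightarrow> 'b set set"
  cost :: "'k set \<Rightarrow> real"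

definition logic_suite :: "('k, 'b) logic_suite \<Rightarrow> bool" where
  "logic_suite L \<longleftrightarrow>
     {} \<in> KB L \<and> (\<forall>kb\<in>KB L. finite kb) \<and>
     (\<forall>S\<in>BS L. finite S) \<and>
     (\<forall>kb\<in>KB L. ACC L kb \<subseteq> BS L) \<and>
     (\<exists>q :: nat poly. \<forall>kb\<in>KB L. \<forall>S\<in>ACC L kb. card S \<le> poly q (card kb)) \<and>
     (\<forall>kb\<in>KB L. cost L kb > 0) \<and>
     (\<exists>kb\<in>KB L. \<forall>kb'\<in>KB L. cost L kb' \<le> cost L kb)"

text \<open>For a \<open>logic_suite\<close> the supremum below is attained, i.e. it is a maximum.\<close>

definition cost_ACC :: "('k, 'b) logic_suite \<Rightarrow> real" where
  "cost_ACC L = (SUP kb\<in>KB L. cost L kb)"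

definition monotonic :: "('k, 'b) logic_suite \<Rightarrow> bool" where
  "monotonic L \<longleftrightarrow>
     (\<forall>kb\<in>KB L. is_singleton (ACC L kb)) \<and>
     (\<forall>kb\<in>KB L. \<forall>kb'\<in>KB L. \<forall>S S'.
        kb \<subseteq> kb' \<longrightarrow> ACC L kb = {S} \<longrightarrow> ACC L kb' = {S'} \<longrightarrow> S \<subseteq> S')"


section \<open>Multi-context systems\<close>

text \<open>Contexts are numbered from \<open>0\<close>.  In a bridge rule, \<open>pos_body\<close> lists the literals
  \<open>(c : p)\<close> and \<open>neg_body\<close> the pairs \<open>(c, p)\<close> of the literals \<open>not (c : p)\<close>.\<close>

datatype ('k, 'b) bridge_rule =
  Bridge_Rule (head: 'k) (pos_body: "(nat \<times> 'b) list") (neg_body: "(nat \<times> 'b) list")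

datatype ('k, 'b) mcs_context =
  Context (suite: "('k, 'b) logic_suite") (bridge_rules: "('k, 'b) bridge_rule set")

type_synonym ('k, 'b) mcs = "('k, 'b) mcs_context list"

definition mcs :: "('k, 'b) mcs \<Rightarrow> bool" where
  "mcs M \<longleftrightarrow> M \<noteq> [] \<and>
     (\<forall>C\<in>set M.
        logic_suite (suite C) \<and> finite (bridge_rules C) \<and>
        (\<forall>r\<in>bridge_rules C.
           (\<forall>(c, p)\<in>set (pos_body r) \<union> set (neg_body r).
              c < length M \<and> (\<exists>S\<in>BS (suite (M ! c)). p \<in> S)) \<and>
           (\<forall>kb\<in>KB (suite C). insert (head r) kb \<in> KB (suite C))))"

definition definite_mcs :: "('k, 'b) mcs \<Rightarrow> bool" where
  "definite_mcs M \<longleftrightarrow> mcs M \<and>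
     (\<forall>C\<in>set M. monotonic (suite C) \<and> (\<forall>r\<in>bridge_rules C. neg_body r = []))"

definition uniform_cost :: "('k, 'b) mcs \<Rightarrow> bool" where
  "uniform_cost M \<longleftrightarrow> (\<forall>C\<in>set M. cost_ACC (suite C) = 1)"

definition num_rules :: "('k, 'b) mcs \<Rightarrow> nat" where
  "num_rules M = (\<Sum>C\<leftarrow>M. card (bridge_rules C))"


section \<open>Equilibria\<close>

definition belief_state :: "('k, 'b) mcs \<Rightarrow> 'b set list \<Rightarrow> bool" where
  "belief_state M S \<longleftrightarrow>
     length S = length M \<and> (\<forall>i<length M. S ! i \<in> BS (suite (M ! i)))"

definition rule_satisfied :: "'b set list \<Rightarrow> ('k, 'b) bridge_rule \<Rightarrow> bool" where
  "rule_satisfied S r \<longleftrightarrow>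
     (\<forall>(c, p)\<in>set (pos_body r). p \<in> S ! c) \<and> (\<forall>(c, p)\<in>set (neg_body r). p \<notin> S ! c)"

definition induced_kb :: "('k, 'b) mcs \<Rightarrow> 'b set list \<Rightarrow> nat \<Rightarrow> 'k set" where
  "induced_kb M S i = {head r |r. r \<in> bridge_rules (M ! i) \<and> rule_satisfied S r}"

definition equilibrium :: "('k, 'b) mcs \<Rightarrow> 'b set list \<Rightarrow> bool" where
  "equilibrium M S \<longleftrightarrow> belief_state M S \<and>
     (\<forall>i<length M. S ! i \<in> ACC (suite (M ! i)) (induced_kb M S i))"

definition minimal_equilibrium :: "('k, 'b) mcs \<Rightarrow> 'b set list \<Rightarrow> bool" where
  "minimal_equilibrium M S \<longleftrightarrow> equilibrium M S \<and>
     (\<forall>T. equilibrium M T \<longrightarrow> list_all2 (\<subseteq>) T S \<longrightarrow> T = S)"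

definition grounded_equilibrium :: "('k, 'b) mcs \<Rightarrow> 'b set list" where
  "grounded_equilibrium M = (THE S. minimal_equilibrium M S)"

definition entails :: "'b set list \<Rightarrow> 'b \<Rightarrow> bool" where
  "entails S p \<longleftrightarrow> (\<exists>i<length S. p \<in> S ! i)"


section \<open>Decision problems\<close>

text \<open>The grounded equilibrium is regarded as the only equilibrium of a definite system when it
  comes to reasoning.\<close>

definition reasoning_equilibria :: "('k, 'b) mcs \<Rightarrow> 'b set list set" where
  "reasoning_equilibria M =
     (if definite_mcs M then {grounded_equilibrium M} else {S. equilibrium M S})"

text \<open>A problem takes a system and a query; consistency has only the dummy query \<open>()\<close>.\<close>

definition consistency :: "('k, 'b) mcs \<Rightarrow> unit \<Rightarrow> bool" where
  "consistency M q \<longleftrightarrow> (\<exists>S. equilibrium M S)"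

definition brave :: "('k, 'b) mcs \<Rightarrow> 'b \<Rightarrow> bool" where
  "brave M p \<longleftrightarrow> (\<exists>S\<in>reasoning_equilibria M. entails S p)"

definition cautious :: "('k, 'b) mcs \<Rightarrow> 'b \<Rightarrow> bool" where
  "cautious M p \<longleftrightarrow> (\<forall>S\<in>reasoning_equilibria M. entails S p)"


section \<open>Algorithms and their cost\<close>

text \<open>All computation other than invoking the semantic operators is free, so a run of a
  deterministic algorithm is a path in a decision tree: the algorithm either answers, or invokes
  the operator of context \<open>i\<close> on a knowledge base \<open>kb\<close> and continues depending on the set of belief
  sets returned.  The tree is a function of the bridge rules (one set per context) and the query
  alone; nothing else about the system is known to the algorithm.\<close>

datatype ('k, 'b) decision_tree =
    Answer bool
  | Invoke nat "'k set" "'b set set \<Rightarrow> ('k, 'b) decision_tree"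

type_synonym ('k, 'b, 'q) algorithm =
  "('k, 'b) bridge_rule set list \<Rightarrow> 'q \<Rightarrow> ('k, 'b) decision_tree"

primrec result :: "(nat \<Rightarrow> 'k set \<Rightarrow> 'b set set) \<Rightarrow> ('k, 'b) decision_tree \<Rightarrow> bool" where
  "result acc (Answer b) = b"
| "result acc (Invoke i kb cont) = result acc (cont (acc i kb))"

primrec invocations ::
    "(nat \<Rightarrow> 'k set \<Rightarrow> 'b set set) \<Rightarrow> ('k, 'b) decision_tree \<Rightarrow> (nat \<times> 'k set) list" where
  "invocations acc (Answer b) = []"
| "invocations acc (Invoke i kb cont) = (i, kb) # invocations acc (cont (acc i kb))"

definition sem_ops :: "('k, 'b) mcs \<Rightarrow> nat \<Rightarrow> 'k set \<Rightarrow> 'b set set" where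
  "sem_ops M i = ACC (suite (M ! i))"

definition run_result :: "('k, 'b, 'q) algorithm \<Rightarrow> ('k, 'b) mcs \<Rightarrow> 'q \<Rightarrow> bool" where
  "run_result A M q = result (sem_ops M) (A (map bridge_rules M) q)"

definition run_invocations ::
    "('k, 'b, 'q) algorithm \<Rightarrow> ('k, 'b) mcs \<Rightarrow> 'q \<Rightarrow> (nat \<times> 'k set) list" where
  "run_invocations A M q = invocations (sem_ops M) (A (map bridge_rules M) q)"

text \<open>Operators may only be invoked on knowledge bases of the respective context.\<close>

definition decides_definite ::
    "('k, 'b, 'q) algorithm \<Rightarrow> (('k, 'b) mcs \<Rightarrow> 'q \<Rightarrow> bool) \<Rightarrow> bool" where
  "decides_definite A problem \<longleftrightarrow>
     (\<forall>M q. definite_mcs M \<longrightarrow>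
        (\<forall>(i, kb)\<in>set (run_invocations A M q). i < length M \<and> kb \<in> KB (suite (M ! i))) \<and>
        run_result A M q = problem M q)"

text \<open>Suprema are taken in the extended nonnegative reals: an unbounded set of costs has supremum
  \<open>\<infinity>\<close>.\<close>

definition Cost :: "('k, 'b, 'q) algorithm \<Rightarrow> ('k, 'b) mcs \<Rightarrow> ennreal" where
  "Cost A M =
     (SUP q. ennreal (\<Sum>(i, kb)\<leftarrow>run_invocations A M q. cost_ACC (suite (M ! i))))"

definition CTime :: "('k, 'b, 'q) algorithm \<Rightarrow> nat \<Rightarrow> nat \<Rightarrow> ennreal" where
  "CTime A n m =
     (SUP M\<in>{M. definite_mcs M \<and> uniform_cost M \<and> length M = n \<and> num_rules M = m}. Cost A M)"

end

theory Submission
  imports Defs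
begin

text \<open>The grounded equilibrium is reached from the empty belief state by repeatedly picking a
  context whose operator was not yet invoked on the knowledge base that the bridge rules currently
  induce, and invoking it there.  By monotonicity the induced knowledge bases only grow, so context
  \<open>i\<close> is invoked at most \<open>1 + |br\<^sub>i|\<close> times, in total at most \<open>n + m\<close> times, and \<open>n + m \<le> n * m\<close> for
  \<open>n, m \<ge> 2\<close>.  In particular a definite system always has an equilibrium, so consistency is decided
  by answering yes without any invocation.\<close>

section \<open>Definite systems\<close>

text \<open>An algorithm is given the bridge rules but not the system, so its tree needs the induced
  knowledge base as a function of the rules alone.\<close>

definition fired_heads :: "('k, 'b) bridge_rule set \<Rightarrow> 'b set list \<Rightarrow> 'k set" where
  "fired_heads R S = {head r |r. r \<in> R \<and> rule_satisfied S r}"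

lemma induced_kb_eq_fired_heads: "induced_kb M S i = fired_heads (bridge_rules (M ! i)) S"
  by (simp add: induced_kb_def fired_heads_def)

lemma
  assumes "definite_mcs M" "i < length M"
  shows definite_mcs_logic_suite: "logic_suite (suite (M ! i))"
    and definite_mcs_monotonic: "monotonic (suite (M ! i))"
    and definite_mcs_finite_rules: "finite (bridge_rules (M ! i))"
  using assms by (auto simp: definite_mcs_def mcs_def)

lemma monotonicD:
  assumes "monotonic L" "kb \<in> KB L" "kb' \<in> KB L" "kb \<subseteq> kb'"
    "ACC L kb = {S}" "ACC L kb' = {S'}"
  shows "S \<subseteq> S'"
  using assms unfolding monotonic_def by blast

text \<open>Without negated literals, enlarging the belief state componentwise can only satisfy more
  rules.\<close>

lemma induced_kb_mono:
  assumes "definite_mcs M" "i < length M" "length S = length M" "list_all2 (\<subseteq>) S T"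
  shows "induced_kb M S i \<subseteq> induced_kb M T i"
proof
  fix x assume "x \<in> induced_kb M S i"
  then obtain r where r: "x = head r" "r \<in> bridge_rules (M ! i)" "rule_satisfied S r"
    by (auto simp: induced_kb_def)
  have "M ! i \<in> set M" using assms(2) by simp
  then have "neg_body r = []" "\<forall>(c, p)\<in>set (pos_body r). c < length M"
    using assms(1) r(2) by (fastforce simp: definite_mcs_def mcs_def)+
  then have "rule_satisfied T r"
    using r(3) assms(3,4) by (fastforce simp: rule_satisfied_def list_all2_conv_all_nth)
  then show "x \<in> induced_kb M T i"
    using r by (auto simp: induced_kb_def)
qed

lemma
  assumes "definite_mcs M" "i < length M"
  shows finite_induced_kb: "finite (induced_kb M S i)"
    and card_induced_kb_le: "card (induced_kb M S i) \<le> card (bridge_rules (M ! i))"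
    and induced_kb_in_KB: "induced_kb M S i \<in> KB (suite (M ! i))"
proof -
  have fin: "finite (bridge_rules (M ! i))"
    using assms by (rule definite_mcs_finite_rules)
  have sub: "induced_kb M S i \<subseteq> head ` bridge_rules (M ! i)"
    by (auto simp: induced_kb_def)
  show finS: "finite (induced_kb M S i)"
    using sub fin by (meson finite_imageI finite_subset)
  show "card (induced_kb M S i) \<le> card (bridge_rules (M ! i))"
    using surj_card_le[OF fin sub] .
  have "M ! i \<in> set M" using assms(2) by simp
  then have base: "{} \<in> KB (suite (M ! i))"
    and ins: "\<And>r kb. r \<in> bridge_rules (M ! i) \<Longrightarrow> kb \<in> KB (suite (M ! i)) \<Longrightarrow>
      insert (head r) kb \<in> KB (suite (M ! i))"
    using assms(1) by (auto simp: definite_mcs_def mcs_def logic_suite_def)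
  \<comment> \<open>\<open>KB\<close> contains {} and is closed under inserting heads of rules, so a
    set of heads is built up one head at a time.\<close>
  have "X \<in> KB (suite (M ! i))" if "finite X" "X \<subseteq> head ` bridge_rules (M ! i)" for X
    using that by (induction rule: finite_induct) (auto intro: base ins)
  then show "induced_kb M S i \<in> KB (suite (M ! i))"
    using finS sub by blast
qed

definition least_equilibrium :: "('k, 'b) mcs \<Rightarrow> 'b set list \<Rightarrow> bool" where
  "least_equilibrium M E \<longleftrightarrow> equilibrium M E \<and> (\<forall>T. equilibrium M T \<longrightarrow> list_all2 (\<subseteq>) E T)"

text \<open>A least equilibrium is minimal, and it lies below any minimal one and hence equals it;
  so the definite description has exactly one candidate.\<close>

lemma grounded_equilibrium_eq:
  assumes "least_equilibrium M E"
  shows "grounded_equilibrium M = E"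
proof -
  have "S = T" if "list_all2 (\<subseteq>) S T" "list_all2 (\<subseteq>) T S" for S T :: "'b set list"
    using list_all2_antisym[of "(\<subseteq>)" "(\<subseteq>)" S T] that by (auto simp: list.rel_eq)
  then have "minimal_equilibrium M S \<longleftrightarrow> S = E" for S
    using assms unfolding least_equilibrium_def minimal_equilibrium_def by metis
  then show ?thesis
    by (simp add: grounded_equilibrium_def)
qed

section \<open>The iteration\<close>

text \<open>\<open>K\<close> records the knowledge base on which each operator was last invoked (\<open>None\<close> if it was
  not), and the natural number is the number of invocations still allowed.\<close>

primrec grounded_tree ::
    "('k, 'b) bridge_rule set list \<Rightarrow> 'b \<Rightarrow> nat \<Rightarrow> 'k set option list \<Rightarrow> 'b set list \<Rightarrow>
      ('k, 'b) decision_tree" where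
  "grounded_tree brs p 0 K S = Answer (entails S p)"
| "grounded_tree brs p (Suc f) K S =
     (if \<exists>i<length brs. K ! i \<noteq> Some (fired_heads (brs ! i) S)
      then let i = (SOME i. i < length brs \<and> K ! i \<noteq> Some (fired_heads (brs ! i) S));
               kb = fired_heads (brs ! i) S
           in Invoke i kb (\<lambda>X. grounded_tree brs p f (K[i := Some kb]) (S[i := the_elem X]))
      else Answer (entails S p))"

text \<open>The allowance is one invocation per context plus one per bridge rule. Starting from
  \<open>None\<close> makes a first invocation due for every context, even on the empty knowledge
  base.\<close>

definition grounded_algorithm :: "('k, 'b, 'b) algorithm" where
  "grounded_algorithm brs p =
     grounded_tree brs p (length brs + (\<Sum>R\<leftarrow>brs. card R))
       (replicate (length brs) None) (replicate (length brs) {})"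

text \<open>The invariant. A recorded knowledge base is only included in the induced one, since
  invoking another context may have enlarged the latter meanwhile.\<close>

definition iteration_state :: "('k, 'b) mcs \<Rightarrow> 'k set option list \<Rightarrow> 'b set list \<Rightarrow> bool" where
  "iteration_state M K S \<longleftrightarrow> length K = length M \<and> length S = length M \<and>
     (\<forall>i<length M. case K ! i of
          None \<Rightarrow> S ! i = {}
        | Some kb \<Rightarrow> kb \<subseteq> induced_kb M S i \<and> kb \<in> KB (suite (M ! i)) \<and>
            ACC (suite (M ! i)) kb = {S ! i}) \<and>
     (\<forall>T. equilibrium M T \<longrightarrow> list_all2 (\<subseteq>) S T)"

text \<open>Potential bounding the number of invocations. \<open>Suc\<close> makes the step from
  \<open>None\<close> to \<open>Some {}\<close> count.\<close>

definition progress :: "'k set option list \<Rightarrow> nat" where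
  "progress K = (\<Sum>k\<leftarrow>K. case k of None \<Rightarrow> 0 | Some kb \<Rightarrow> Suc (card kb))"

text \<open>Recorded knowledge bases lie inside the induced ones, which have at most one element per
  bridge rule.\<close>

lemma progress_le:
  assumes "definite_mcs M" "iteration_state M K S"
  shows "progress K \<le> length M + num_rules M"
proof -
  have "(case K ! i of None \<Rightarrow> 0 | Some kb \<Rightarrow> Suc (card kb)) \<le> Suc (card (bridge_rules (M ! i)))"
    if i: "i < length M" for i
  proof (cases "K ! i")
    case (Some kb)
    then have "kb \<subseteq> induced_kb M S i"
      using assms(2) i by (auto simp: iteration_state_def split: option.splits)
    then have "card kb \<le> card (bridge_rules (M ! i))"
      using card_mono[OF finite_induced_kb[OF assms(1) i]] card_induced_kb_le[OF assms(1) i]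
      by (meson le_trans)
    then show ?thesis using Some by simp
  qed simp
  then have "progress K \<le> (\<Sum>i<length M. Suc (card (bridge_rules (M ! i))))"
    using assms(2)
    by (auto simp: progress_def sum_list_sum_nth iteration_state_def atLeast0LessThan
        intro!: sum_mono)
  also have "\<dots> = length M + num_rules M"
    by (simp add: num_rules_def sum_list_sum_nth atLeast0LessThan sum.distrib sum_Suc)
  finally show ?thesis .
qed

lemma iteration_step:
  assumes M: "definite_mcs M" and st: "iteration_state M K S"
    and i: "i < length M" "K ! i \<noteq> Some (induced_kb M S i)"
  defines "kb \<equiv> induced_kb M S i"
  defines "K' \<equiv> K[i := Some kb]"
    and "S' \<equiv> S[i := the_elem (ACC (suite (M ! i)) kb)]"
  shows "iteration_state M K' S'" "progress K < progress K'"
proof -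
  have len: "length K = length M" "length S = length M"
    using st by (auto simp: iteration_state_def)
  have mon: "monotonic (suite (M ! i))"
    by (rule definite_mcs_monotonic[OF M i(1)])
  have kb: "kb \<in> KB (suite (M ! i))"
    unfolding kb_def by (rule induced_kb_in_KB[OF M i(1)])
  then obtain s where s: "ACC (suite (M ! i)) kb = {s}"
    using mon by (auto simp: monotonic_def is_singleton_def)
  then have S': "S' = S[i := s]"
    by (simp add: S'_def)
  have old: "case K ! i of None \<Rightarrow> S ! i = {}
      | Some k \<Rightarrow> k \<subseteq> kb \<and> k \<in> KB (suite (M ! i)) \<and> ACC (suite (M ! i)) k = {S ! i}"
    using st i(1) unfolding kb_def by (simp add: iteration_state_def)
  \<comment> \<open>The old component is either the initial {} or the output on a smaller knowledge
    base.\<close>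
  have "S ! i \<subseteq> s"
  proof (cases "K ! i")
    case (Some k)
    then have "k \<subseteq> kb" "k \<in> KB (suite (M ! i))" "ACC (suite (M ! i)) k = {S ! i}"
      using old by simp_all
    then show ?thesis
      using monotonicD[OF mon _ kb _ _ s] by blast
  qed (use old in simp)
  then have SS': "list_all2 (\<subseteq>) S S'"
    using i(1) len by (simp add: list_all2_conv_all_nth S' nth_list_update)
  \<comment> \<open>This keeps the records of all other contexts valid.\<close>
  have grow: "induced_kb M S j \<subseteq> induced_kb M S' j" if "j < length M" for j
    using induced_kb_mono[OF M that len(2) SS'] .
  \<comment> \<open>\<open>T ! i\<close> is the output on the knowledge base induced by
    \<open>T\<close>, which contains \<open>kb\<close> because \<open>S\<close> lies below
    \<open>T\<close>; monotonicity then puts \<open>s\<close> below \<open>T ! i\<close>.\<close>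
  have "list_all2 (\<subseteq>) S' T" if T: "equilibrium M T" for T
  proof -
    have ST: "list_all2 (\<subseteq>) S T"
      using st T by (auto simp: iteration_state_def)
    have kbT: "induced_kb M T i \<in> KB (suite (M ! i))"
      by (rule induced_kb_in_KB[OF M i(1)])
    have "T ! i \<in> ACC (suite (M ! i)) (induced_kb M T i)"
      using T i(1) by (auto simp: equilibrium_def)
    then have "ACC (suite (M ! i)) (induced_kb M T i) = {T ! i}"
      using kbT mon by (auto simp: monotonic_def is_singleton_def)
    moreover have "kb \<subseteq> induced_kb M T i"
      unfolding kb_def by (rule induced_kb_mono[OF M i(1) len(2) ST])
    ultimately have "s \<subseteq> T ! i"
      using monotonicD[OF mon kb kbT _ s] by blast
    then show ?thesis
      using ST i(1) len by (simp add: list_all2_conv_all_nth S' nth_list_update)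
  qed
  moreover have "case K' ! j of None \<Rightarrow> S' ! j = {}
      | Some k \<Rightarrow> k \<subseteq> induced_kb M S' j \<and> k \<in> KB (suite (M ! j)) \<and>
          ACC (suite (M ! j)) k = {S' ! j}" if j: "j < length M" for j
  proof (cases "j = i")
    case True
    then show ?thesis
      using i(1) len s kb grow[OF i(1)] by (simp add: K'_def S' kb_def)
  next
    case False
    have "case K ! j of None \<Rightarrow> S ! j = {}
      | Some k \<Rightarrow> k \<subseteq> induced_kb M S j \<and> k \<in> KB (suite (M ! j)) \<and>
          ACC (suite (M ! j)) k = {S ! j}"
      using st j by (simp add: iteration_state_def)
    then show ?thesis
      using False grow[OF j] by (auto simp: K'_def S' split: option.splits)
  qed
  moreover have "length K' = length M" "length S' = length M"
    by (simp_all add: K'_def S' len)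
  ultimately show "iteration_state M K' S'"
    by (simp add: iteration_state_def)
  let ?w = "\<lambda>k :: 'a set option. case k of None \<Rightarrow> 0 | Some kb \<Rightarrow> Suc (card kb)"
  have "?w (K ! i) < ?w (K' ! i)"
  proof (cases "K ! i")
    case None
    then show ?thesis using i(1) len by (simp add: K'_def)
  next
    case (Some k)
    \<comment> \<open>Inclusion comes from the invariant, strictness from the choice of
      \<open>i\<close> as a context with an outdated record.\<close>
    then have "k \<subset> kb" using old i(2) by (auto simp: kb_def)
    then have "card k < card kb"
      unfolding kb_def by (rule psubset_card_mono[OF finite_induced_kb[OF M i(1)]])
    then show ?thesis using Some i(1) len by (simp add: K'_def)
  qed
  moreover have "?w (K ! j) \<le> ?w (K' ! j)" if "j < length M" for j
    using calculation by (cases "j = i") (simp_all add: K'_def)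
  ultimately have "(\<Sum>j<length M. ?w (K ! j)) < (\<Sum>j<length M. ?w (K' ! j))"
    using i(1) by (intro sum_strict_mono_ex1) auto
  then show "progress K < progress K'"
    by (simp add: progress_def sum_list_sum_nth atLeast0LessThan len K'_def)
qed

text \<open>Once every record is up to date, the invariant says that each component is the output on
  its own induced knowledge base, and that the state lies below all equilibria.\<close>

lemma iteration_fixpoint:
  assumes M: "definite_mcs M" and st: "iteration_state M K S"
    and fp: "\<And>i. i < length M \<Longrightarrow> K ! i = Some (induced_kb M S i)"
  shows "least_equilibrium M S"
proof -
  have len: "length S = length M"
    using st by (simp add: iteration_state_def)
  have acc: "ACC (suite (M ! i)) (induced_kb M S i) = {S ! i}" if "i < length M" for i
  proof -
    have "case K ! i of None \<Rightarrow> S ! i = {}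
      | Some k \<Rightarrow> k \<subseteq> induced_kb M S i \<and> k \<in> KB (suite (M ! i)) \<and>
          ACC (suite (M ! i)) k = {S ! i}"
      using st that by (simp add: iteration_state_def)
    then show ?thesis
      using fp[OF that] by simp
  qed
  have "S ! i \<in> BS (suite (M ! i))" if "i < length M" for i
    using acc[OF that] induced_kb_in_KB[OF M that, of S] definite_mcs_logic_suite[OF M that]
    by (fastforce simp: logic_suite_def)
  then have "equilibrium M S"
    using acc len by (simp add: equilibrium_def belief_state_def)
  then show ?thesis
    using st by (simp add: least_equilibrium_def iteration_state_def)
qed

text \<open>The assumption on \<open>f\<close> says that the allowance covers the potential still to
  be gained, so it cannot run out while some record is outdated.\<close>

lemma grounded_tree_correct:
  assumes M: "definite_mcs M"
    and "iteration_state M K S" "length M + num_rules M \<le> progress K + f"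
  shows "\<exists>E. least_equilibrium M E \<and>
      result (sem_ops M) (grounded_tree (map bridge_rules M) p f K S) = entails E p"
    and "\<forall>(i, kb)\<in>set (invocations (sem_ops M) (grounded_tree (map bridge_rules M) p f K S)).
      i < length M \<and> kb \<in> KB (suite (M ! i))"
proof -
  let ?open = "\<lambda>K S i. i < length M \<and> K ! i \<noteq> Some (induced_kb M S i)"
  let ?t = "grounded_tree (map bridge_rules M) p"
  have "(\<exists>E. least_equilibrium M E \<and> result (sem_ops M) (?t f K S) = entails E p) \<and>
    (\<forall>(i, kb)\<in>set (invocations (sem_ops M) (?t f K S)).
      i < length M \<and> kb \<in> KB (suite (M ! i)))"
    using assms(2,3)
  proof (induction f arbitrary: K S)
    case 0
    \<comment> \<open>The potential is already at its maximum; one more step would push it beyond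
      the bound of \<open>progress_le\<close>.\<close>
    have "\<not> ?open K S i" for i
      using iteration_step[OF M 0(1), of i] 0(2) progress_le[OF M]
      by (metis add.right_neutral le_trans not_less)
    then show ?case
      using iteration_fixpoint[OF M 0(1)] by auto
  next
    case (Suc f)
    show ?case
    proof (cases "\<exists>i. ?open K S i")
      case True
      define i where "i = (SOME i. ?open K S i)"
      have i: "?open K S i"
        unfolding i_def using True by (rule someI_ex)
      have i_eq: "(SOME i. i < length (map bridge_rules M) \<and>
          K ! i \<noteq> Some (fired_heads (map bridge_rules M ! i) S)) = i"
        unfolding i_def
        by (rule arg_cong[where f = Eps]) (simp add: induced_kb_eq_fired_heads cong: conj_cong)
      let ?kb = "induced_kb M S i"
      have t: "?t (Suc f) K S = Invoke i ?kb
          (\<lambda>X. ?t f (K[i := Some ?kb]) (S[i := the_elem X]))"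
        using i unfolding grounded_tree.simps i_eq Let_def
        by (auto simp: induced_kb_eq_fired_heads)
      let ?K' = "K[i := Some ?kb]" and ?S' = "S[i := the_elem (sem_ops M i ?kb)]"
      have "iteration_state M ?K' ?S'" "progress K < progress ?K'"
        using iteration_step[OF M Suc.prems(1), of i] i by (simp_all add: sem_ops_def)
      \<comment> \<open>The potential gains at least the one unit that the allowance loses.\<close>
      moreover have "length M + num_rules M \<le> progress ?K' + f"
        using calculation(2) Suc.prems(2) by linarith
      ultimately have "(\<exists>E. least_equilibrium M E \<and>
            result (sem_ops M) (?t f ?K' ?S') = entails E p) \<and>
          (\<forall>(i, kb)\<in>set (invocations (sem_ops M) (?t f ?K' ?S')).
            i < length M \<and> kb \<in> KB (suite (M ! i)))"
        by (intro Suc.IH)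
      moreover have "?kb \<in> KB (suite (M ! i))"
        using induced_kb_in_KB[OF M] i by blast
      ultimately show ?thesis
        unfolding t using i by simp
    next
      case False
      then have "?t (Suc f) K S = Answer (entails S p)"
        by (auto simp: induced_kb_eq_fired_heads)
      moreover have "least_equilibrium M S"
        using iteration_fixpoint[OF M Suc.prems(1)] False by blast
      ultimately show ?thesis by auto
    qed
  qed
  then show "\<exists>E. least_equilibrium M E \<and> result (sem_ops M) (?t f K S) = entails E p"
    and "\<forall>(i, kb)\<in>set (invocations (sem_ops M) (?t f K S)).
      i < length M \<and> kb \<in> KB (suite (M ! i))"
    by blast+
qed

text \<open>Each \<open>Invoke\<close> uses up one unit of the allowance, whatever the operators
  return.\<close>

lemma length_invocations_grounded_tree:
  "length (invocations acc (grounded_tree brs p f K S)) \<le> f"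
  by (induction f arbitrary: K S) (auto simp: Let_def)

section \<open>Correctness and cost of the algorithm\<close>

lemma iteration_state_initial:
  "iteration_state M (replicate (length M) None) (replicate (length M) {})"
  by (auto simp: iteration_state_def list_all2_conv_all_nth equilibrium_def belief_state_def)

lemma num_rules_eq: "num_rules M = (\<Sum>R\<leftarrow>map bridge_rules M. card R)"
  by (simp add: num_rules_def comp_def)

lemma grounded_algorithm_correct:
  assumes "definite_mcs M"
  shows "\<exists>E. least_equilibrium M E \<and> run_result grounded_algorithm M p = entails E p"
    and "\<forall>(i, kb)\<in>set (run_invocations grounded_algorithm M p).
      i < length M \<and> kb \<in> KB (suite (M ! i))"
  using grounded_tree_correct[OF assms iteration_state_initial,
      where f = "length M + num_rules M"]
  by (simp_all add: run_result_def run_invocations_def grounded_algorithm_def num_rules_eq)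

lemma length_run_invocations_grounded_algorithm:
  "length (run_invocations grounded_algorithm M p) \<le> length M + num_rules M"
  using length_invocations_grounded_tree
  by (simp add: run_invocations_def grounded_algorithm_def num_rules_eq)

lemma CTime_grounded_algorithm:
  "CTime (grounded_algorithm :: ('k, 'b, 'b) algorithm) n m \<le> of_nat (n + m)"
  unfolding CTime_def Cost_def
proof (intro SUP_least)
  fix M :: "('k, 'b) mcs" and p :: 'b
  assume "M \<in> {M. definite_mcs M \<and> uniform_cost M \<and> length M = n \<and> num_rules M = m}"
  then have M: "definite_mcs M" "uniform_cost M" "length M = n" "num_rules M = m"
    by auto
  let ?I = "run_invocations grounded_algorithm M p"
  \<comment> \<open>Uniform cost concerns contexts of \<open>M\<close> only; correctness supplies
    \<open>i < length M\<close>.\<close>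
  have "cost_ACC (suite (M ! i)) = 1" if "(i, kb) \<in> set ?I" for i kb
    using grounded_algorithm_correct(2)[OF M(1), of p] that M(2)
    by (auto simp: uniform_cost_def)
  then have "(\<Sum>(i, kb)\<leftarrow>?I. cost_ACC (suite (M ! i))) = (\<Sum>x\<leftarrow>?I. 1)"
    by (intro arg_cong[where f = sum_list] map_cong) auto
  also have "\<dots> = real (length ?I)"
    by (simp add: sum_list_triv)
  finally show "ennreal (\<Sum>(i, kb)\<leftarrow>?I. cost_ACC (suite (M ! i))) \<le> of_nat (n + m)"
    using length_run_invocations_grounded_algorithm[of M p] M(3,4)
    by (simp add: ennreal_of_nat_eq_real_of_nat del: of_nat_add)
qed

lemma
  shows decides_definite_brave:
      "decides_definite (grounded_algorithm :: ('k, 'b, 'b) algorithm) brave"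
    and decides_definite_cautious:
      "decides_definite (grounded_algorithm :: ('k, 'b, 'b) algorithm) cautious"
proof -
  \<comment> \<open>For a definite system the set of equilibria to reason about is a singleton, so
    both problems coincide.\<close>
  have "brave M p = entails (grounded_equilibrium M) p"
    "cautious M p = entails (grounded_equilibrium M) p"
    if "definite_mcs M" for M :: "('k, 'b) mcs" and p
    using that by (simp_all add: brave_def cautious_def reasoning_equilibria_def)
  moreover have "run_result grounded_algorithm M p = entails (grounded_equilibrium M) p"
    if "definite_mcs M" for M :: "('k, 'b) mcs" and p
    using grounded_algorithm_correct(1)[OF that, of p] grounded_equilibrium_eq by metis
  ultimately show "decides_definite (grounded_algorithm :: ('k, 'b, 'b) algorithm) brave"
    and "decides_definite (grounded_algorithm :: ('k, 'b, 'b) algorithm) cautious"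
    by (auto simp only: decides_definite_def intro!: grounded_algorithm_correct(2))
qed

text \<open>For reasoning, \<open>n + m \<le> n * m\<close> needs both factors to be at least 2.
  With \<open>m = 0\<close> the product would forbid all invocations, although the answer depends on
  the outputs on {}.\<close>

theorem proposition15:
  shows "(\<exists>A :: ('k, 'b, unit) algorithm.
            decides_definite A consistency \<and>
            (\<forall>n m. CTime A n m \<le> of_nat (n * m)) \<and>
            (\<forall>M. definite_mcs M \<longrightarrow>
               Cost A M \<le> ennreal (MAX i\<in>{..<length M}. cost_ACC (suite (M ! i)))
                            * CTime A (length M) (num_rules M))) \<and>
         (\<exists>A :: ('k, 'b, 'b) algorithm.
            decides_definite A brave \<and>
            (\<forall>n m. n \<ge> 2 \<longrightarrow> m \<ge> 2 \<longrightarrow> CTime A n m \<le> of_nat (n * m))) \<and>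
         (\<exists>A :: ('k, 'b, 'b) algorithm.
            decides_definite A cautious \<and>
            (\<forall>n m. n \<ge> 2 \<longrightarrow> m \<ge> 2 \<longrightarrow> CTime A n m \<le> of_nat (n * m)))"
proof (intro conjI)
  have "CTime (grounded_algorithm :: ('k, 'b, 'b) algorithm) n m \<le> of_nat (n * m)"
    if "n \<ge> 2" "m \<ge> 2" for n m
  proof -
    \<comment> \<open>The sum is at most twice the larger number, and the smaller one is at least
      2.\<close>
    have "n + m \<le> n * m"
    proof (cases "n \<le> m")
      case True
      then have "n + m \<le> 2 * m" by simp
      also have "\<dots> \<le> n * m" using that by simp
      finally show ?thesis .
    next
      case False
      then have "n + m \<le> n * 2" by simp
      also have "\<dots> \<le> n * m" using that by simp
      finally show ?thesis .
    qed
    then show ?thesis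
      using CTime_grounded_algorithm[of n m, where 'k = 'k and 'b = 'b] of_nat_mono order_trans
      by blast
  qed
  then show "\<exists>A :: ('k, 'b, 'b) algorithm. decides_definite A brave \<and>
      (\<forall>n m. n \<ge> 2 \<longrightarrow> m \<ge> 2 \<longrightarrow> CTime A n m \<le> of_nat (n * m))"
    and "\<exists>A :: ('k, 'b, 'b) algorithm. decides_definite A cautious \<and>
      (\<forall>n m. n \<ge> 2 \<longrightarrow> m \<ge> 2 \<longrightarrow> CTime A n m \<le> of_nat (n * m))"
    using decides_definite_brave decides_definite_cautious by blast+
next
  define A :: "('k, 'b, unit) algorithm" where "A = (\<lambda>brs q. Answer True)"
  have cost: "Cost A M = 0" for M
    by (simp add: Cost_def A_def run_invocations_def)
  then have "CTime A n m = 0" for n m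
    \<comment> \<open>Reading 0 as \<open>bot\<close> also covers a supremum over no systems, as for
      \<open>n = 0\<close>.\<close>
    by (simp add: CTime_def bot_ennreal[symmetric])
  moreover have "decides_definite A consistency"
    \<comment> \<open>Used only for the existence of an equilibrium, which makes the constant answer
      right.\<close>
    using grounded_algorithm_correct(1)
    by (fastforce simp: decides_definite_def A_def run_invocations_def run_result_def
        consistency_def least_equilibrium_def)
  ultimately show "\<exists>A :: ('k, 'b, unit) algorithm. decides_definite A consistency \<and>
      (\<forall>n m. CTime A n m \<le> of_nat (n * m)) \<and>
      (\<forall>M. definite_mcs M \<longrightarrow>
         Cost A M \<le> ennreal (MAX i\<in>{..<length M}. cost_ACC (suite (M ! i)))
                      * CTime A (length M) (num_rules M))"
    using cost by (intro exI[of _ A]) auto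
qed

end
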